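(* Let $G$ be an arbitrary finite group, $H\subseteq G$ a subgroup, and $R$ any domain-like $G$-Tambara functor such that the restriction $R(G/G)\to R(G/H)$ is not injective. Then the $H$th stratum of $\mathrm{Spec}(R)$ is not open.
   Context: Tambara functors are evaluated on transitive $G$-sets and extended by $R(X \sqcup Y) = R(X) \times R(Y)$. A Tambara ideal $I$ of a $G$-Tambara functor $R$ is a collection of ideals $I(G/H) \subseteq R(G/H)$ closed under all transfers, norms, restrictions and conjugations; extend by $I(X\sqcup Y)=I(X)\times I(Y)$. The product $I\cdot J$ is the smallest Tambara ideal containing all $I(G/H)\cdot J(G/H)$. A Tambara ideal $\mathfrak{p}$ is prime if $\mathfrak{p}\neq R$ and $I\cdot J\subseteq \mathfrak{p}$ implies $I\subseteq\mathfrak{p}$ or $J\subseteq\mathfrak{p}$. $R$ is domain-like if its zero ideal is prime. The Nakaoka spectrum $\mathrm{Spec}(R)$ is the set of prime Tambara ideals with closed sets $V(I)=\{\mathfrak{p}: I\subseteq\mathfrak{p}\}$. Strata: $\mathrm{Res}_H^G R$ is the $H$-Tambara functor with $\mathrm{Res}_H^G R(H/L)=R(G/L)$; its right adjoint is $\mathrm{CoInd}_H^G$, with $\mathrm{CoInd}_H^G S(X)=S(\mathrm{Res}_H^G X)$ ($X$ regarded as an $H$-set), and for an ideal $I$ of $S$, $\mathrm{CoInd}_H^G I(X)=I(\mathrm{Res}_H^G X)$. Let $\eta: R\to\mathrm{CoInd}_H^G\mathrm{Res}_H^G R$ be the adjunction unit. The map $\mathfrak{q}\mapsto\mathrm{CoInd}_H^G\mathfrak{q}$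 is a homeomorphism $\mathrm{Spec}(\mathrm{Res}_H^G R)\cong\mathrm{Spec}(\mathrm{CoInd}_H^G\mathrm{Res}_H^G R)$. The $H$th stratum of $\mathrm{Spec}(R)$ is the image of the continuous map $\mathrm{Spec}(\mathrm{Res}_H^G R)\to\mathrm{Spec}(R)$, $\mathfrak{q}\mapsto\eta^{-1}(\mathrm{CoInd}_H^G\mathfrak{q})$. *)

theory Defs
  imports "HOL-Algebra.Group_Action" "HOL-Algebra.Left_Coset" "HOL-Algebra.Ideal_Product"
    "HOL-Analysis.Abstract_Topology"
begin

section \<open>Finite \<open>G\<close>-sets\<close>

record ('g, 'x) gset =
  pts :: "'x set"
  act :: "'g \<Rightarrow> 'x \<Rightarrow> 'x"

definition finite_gset :: "('g, 'm) monoid_scheme \<Rightarrow> ('g, 'x) gset \<Rightarrow> bool" where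
  "finite_gset G X \<longleftrightarrow> group_action G (pts X) (act X) \<and> finite (pts X)"

definition gmap :: "('g, 'm) monoid_scheme \<Rightarrow> ('g, 'x) gset \<Rightarrow> ('g, 'y) gset \<Rightarrow> ('x \<Rightarrow> 'y) \<Rightarrow> bool" where
  "gmap G X Y f \<longleftrightarrow> f \<in> pts X \<rightarrow> pts Y \<and>
     (\<forall>g\<in>carrier G. \<forall>x\<in>pts X. f (act X g x) = act Y g (f x))"

abbreviation stab :: "('g, 'm) monoid_scheme \<Rightarrow> ('g, 'x) gset \<Rightarrow> 'x \<Rightarrow> 'g set" where
  "stab G X \<equiv> stabilizer G (act X)"

definition conj_set :: "('g, 'm) monoid_scheme \<Rightarrow> 'g \<Rightarrow> 'g set \<Rightarrow> 'g set" where
  "conj_set G g K = g <#\<^bsub>G\<^esub> K #>\<^bsub>G\<^esub> inv\<^bsub>G\<^esub> g"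

definition coset_gset :: "('g, 'm) monoid_scheme \<Rightarrow> 'g set \<Rightarrow> ('g, 'g set) gset" where
  "coset_gset G K = \<lparr>pts = lcosets\<^bsub>G\<^esub> K, act = (\<lambda>g. \<lambda>C\<in>lcosets\<^bsub>G\<^esub> K. g <#\<^bsub>G\<^esub> C)\<rparr>"

definition pullback :: "('g, 'x) gset \<Rightarrow> ('g, 'z) gset \<Rightarrow> ('x \<Rightarrow> 'y) \<Rightarrow> ('z \<Rightarrow> 'y) \<Rightarrow> ('g, 'x \<times> 'z) gset" where
  "pullback X Z f h =
     (let P = {(x, z). x \<in> pts X \<and> z \<in> pts Z \<and> f x = h z}
      in \<lparr>pts = P, act = (\<lambda>g. \<lambda>(x, z)\<in>P. (act X g x, act Z g z))\<rparr>)"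

text \<open>For \<open>A \<rightarrow> X \<rightarrow> Y\<close> (maps \<open>p\<close> and \<open>f\<close>) the dependent product: its points over \<open>y\<close> are
  the sections of \<open>p\<close> over the fibre of \<open>f\<close> at \<open>y\<close>, and \<open>G\<close> acts by conjugation.\<close>

definition dep_prod :: "('g, 'm) monoid_scheme \<Rightarrow> ('g, 'a) gset \<Rightarrow> ('g, 'x) gset \<Rightarrow> ('g, 'y) gset
    \<Rightarrow> ('a \<Rightarrow> 'x) \<Rightarrow> ('x \<Rightarrow> 'y) \<Rightarrow> ('g, 'y \<times> ('x \<Rightarrow> 'a)) gset" where
  "dep_prod G A X Y p f =
     (let P = {(y, s). y \<in> pts Y \<and>
                 s \<in> (\<Pi>\<^sub>E x\<in>{x \<in> pts X. f x = y}. {a \<in> pts A. p a = x})}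
      in \<lparr>pts = P,
          act = (\<lambda>g. \<lambda>(y, s)\<in>P. (act Y g y,
             \<lambda>x\<in>{x \<in> pts X. f x = act Y g y}. act A g (s (act X (inv\<^bsub>G\<^esub> g) x))))\<rparr>)"


section \<open>Data of a Tambara functor and its extension to finite \<open>G\<close>-sets\<close>

text \<open>The data are indexed by subgroups: \<open>tval R K\<close> is \<open>R(G/K)\<close>. For \<open>K \<subseteq> L\<close>,
  \<open>tres R K L : R(G/L) \<rightarrow> R(G/K)\<close>, while \<open>ttr R K L, tnm R K L : R(G/K) \<rightarrow> R(G/L)\<close>;
  \<open>tcj R g K : R(G/K) \<rightarrow> R(G/gKg\<^sup>-\<^sup>1)\<close>. Values at sets that are not subgroups are irrelevant.\<close>

record ('g, 'r) tambara =
  tval :: "'g set \<Rightarrow> 'r ring"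
  tres :: "'g set \<Rightarrow> 'g set \<Rightarrow> 'r \<Rightarrow> 'r"
  ttr :: "'g set \<Rightarrow> 'g set \<Rightarrow> 'r \<Rightarrow> 'r"
  tnm :: "'g set \<Rightarrow> 'g set \<Rightarrow> 'r \<Rightarrow> 'r"
  tcj :: "'g \<Rightarrow> 'g set \<Rightarrow> 'r \<Rightarrow> 'r"

text \<open>The extension \<open>R(X \<squnion> Y) = R(X) \<times> R(Y)\<close>, without choosing orbit representatives: an element
  of \<open>R(X)\<close> is a family \<open>s x \<in> R(G/G\<^sub>x)\<close> compatible with conjugation. Evaluation at one point of
  each orbit identifies it with the product of the \<open>R(G/G\<^sub>x)\<close> over the orbits.\<close>

definition ext_carrier :: "('g, 'm) monoid_scheme \<Rightarrow> ('g, 'r) tambara \<Rightarrow> ('g, 'x) gset \<Rightarrow> ('x \<Rightarrow> 'r) set" where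
  "ext_carrier G R X =
     {s \<in> (\<Pi>\<^sub>E x\<in>pts X. carrier (tval R (stab G X x))).
        \<forall>g\<in>carrier G. \<forall>x\<in>pts X. s (act X g x) = tcj R g (stab G X x) (s x)}"

definition ext_ring :: "('g, 'm) monoid_scheme \<Rightarrow> ('g, 'r) tambara \<Rightarrow> ('g, 'x) gset \<Rightarrow> ('x \<Rightarrow> 'r) ring" where
  "ext_ring G R X =
     \<lparr>carrier = ext_carrier G R X,
      mult = (\<lambda>s t. \<lambda>x\<in>pts X. s x \<otimes>\<^bsub>tval R (stab G X x)\<^esub> t x),
      one = (\<lambda>x\<in>pts X. \<one>\<^bsub>tval R (stab G X x)\<^esub>),
      zero = (\<lambda>x\<in>pts X. \<zero>\<^bsub>tval R (stab G X x)\<^esub>),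
      add = (\<lambda>s t. \<lambda>x\<in>pts X. s x \<oplus>\<^bsub>tval R (stab G X x)\<^esub> t x)\<rparr>"

text \<open>Restriction, transfer and norm along a \<open>G\<close>-map \<open>f : X \<rightarrow> Y\<close>. The value of a transfer (norm)
  at \<open>y\<close> is the sum (product) over the \<open>G\<^sub>y\<close>-orbits in the fibre of \<open>y\<close>; by conjugation invariance
  the representative chosen in each orbit does not matter.\<close>

definition ext_res :: "('g, 'm) monoid_scheme \<Rightarrow> ('g, 'r) tambara \<Rightarrow> ('g, 'x) gset \<Rightarrow> ('g, 'y) gset
    \<Rightarrow> ('x \<Rightarrow> 'y) \<Rightarrow> ('y \<Rightarrow> 'r) \<Rightarrow> 'x \<Rightarrow> 'r" where
  "ext_res G R X Y f t = (\<lambda>x\<in>pts X. tres R (stab G X x) (stab G Y (f x)) (t (f x)))"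

definition fibre_orbits :: "('g, 'm) monoid_scheme \<Rightarrow> ('g, 'x) gset \<Rightarrow> ('g, 'y) gset
    \<Rightarrow> ('x \<Rightarrow> 'y) \<Rightarrow> 'y \<Rightarrow> 'x set set" where
  "fibre_orbits G X Y f y = orbits (G\<lparr>carrier := stab G Y y\<rparr>) {x \<in> pts X. f x = y} (act X)"

definition ext_tr :: "('g, 'm) monoid_scheme \<Rightarrow> ('g, 'r) tambara \<Rightarrow> ('g, 'x) gset \<Rightarrow> ('g, 'y) gset
    \<Rightarrow> ('x \<Rightarrow> 'y) \<Rightarrow> ('x \<Rightarrow> 'r) \<Rightarrow> 'y \<Rightarrow> 'r" where
  "ext_tr G R X Y f s = (\<lambda>y\<in>pts Y.
     finsum (tval R (stab G Y y))
       (\<lambda>orb. let x = (SOME x. x \<in> orb) in ttr R (stab G X x) (stab G Y y) (s x))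
       (fibre_orbits G X Y f y))"

definition ext_nm :: "('g, 'm) monoid_scheme \<Rightarrow> ('g, 'r) tambara \<Rightarrow> ('g, 'x) gset \<Rightarrow> ('g, 'y) gset
    \<Rightarrow> ('x \<Rightarrow> 'y) \<Rightarrow> ('x \<Rightarrow> 'r) \<Rightarrow> 'y \<Rightarrow> 'r" where
  "ext_nm G R X Y f s = (\<lambda>y\<in>pts Y.
     finprod (tval R (stab G Y y))
       (\<lambda>orb. let x = (SOME x. x \<in> orb) in tnm R (stab G X x) (stab G Y y) (s x))
       (fibre_orbits G X Y f y))"


section \<open>Tambara functors\<close>

text \<open>The last three axioms concern arbitrary finite \<open>G\<close>-sets: base change for transfers and for
  norms along pullback squares, and the distributive law \<open>N\<^sub>f T\<^sub>p = T\<^sub>q N\<^sub>f\<^sub>' R\<^sub>e\<close> of the exponential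
  diagram of \<open>A \<rightarrow> X \<rightarrow> Y\<close>. They quantify over \<open>G\<close>-sets with points in \<open>'g set \<times> nat\<close>; this type
  is infinite, so every finite \<open>G\<close>-set is isomorphic to one of these.
  Norms of sums, \<open>N(0) = 0\<close> and Frobenius reciprocity are instances of the distributive law
  (take \<open>p\<close> or \<open>f\<close> to be a fold map, or \<open>A\<close> empty).\<close>

locale tambara_functor = group G for G :: "('g, 'm) monoid_scheme" (structure) +
  fixes R :: "('g, 'r) tambara"
  assumes finite_group: "finite (carrier G)"
    and val_cring: "subgroup K G \<Longrightarrow> cring (tval R K)"
    and res_hom: "\<lbrakk>subgroup K G; subgroup L G; K \<subseteq> L\<rbrakk> \<Longrightarrow>
        tres R K L \<in> ring_hom (tval R L) (tval R K)"
    and tr_hom: "\<lbrakk>subgroup K G; subgroup L G; K \<subseteq> L\<rbrakk> \<Longrightarrow>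
        ttr R K L \<in> hom (add_monoid (tval R K)) (add_monoid (tval R L))"
    and nm_hom: "\<lbrakk>subgroup K G; subgroup L G; K \<subseteq> L\<rbrakk> \<Longrightarrow>
        tnm R K L \<in> hom (tval R K) (tval R L)"
    and nm_one: "\<lbrakk>subgroup K G; subgroup L G; K \<subseteq> L\<rbrakk> \<Longrightarrow>
        tnm R K L \<one>\<^bsub>tval R K\<^esub> = \<one>\<^bsub>tval R L\<^esub>"
    and cj_hom: "\<lbrakk>subgroup K G; g \<in> carrier G\<rbrakk> \<Longrightarrow>
        tcj R g K \<in> ring_hom (tval R K) (tval R (conj_set G g K))"
    and res_refl: "\<lbrakk>subgroup K G; r \<in> carrier (tval R K)\<rbrakk> \<Longrightarrow> tres R K K r = r"
    and tr_refl: "\<lbrakk>subgroup K G; r \<in> carrier (tval R K)\<rbrakk> \<Longrightarrow> ttr R K K r = r"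
    and nm_refl: "\<lbrakk>subgroup K G; r \<in> carrier (tval R K)\<rbrakk> \<Longrightarrow> tnm R K K r = r"
    and cj_inner: "\<lbrakk>subgroup K G; k \<in> K; r \<in> carrier (tval R K)\<rbrakk> \<Longrightarrow> tcj R k K r = r"
    and res_trans: "\<lbrakk>subgroup K G; subgroup L G; subgroup M G; K \<subseteq> L; L \<subseteq> M; r \<in> carrier (tval R M)\<rbrakk> \<Longrightarrow>
        tres R K L (tres R L M r) = tres R K M r"
    and tr_trans: "\<lbrakk>subgroup K G; subgroup L G; subgroup M G; K \<subseteq> L; L \<subseteq> M; r \<in> carrier (tval R K)\<rbrakk> \<Longrightarrow>
        ttr R L M (ttr R K L r) = ttr R K M r"
    and nm_trans: "\<lbrakk>subgroup K G; subgroup L G; subgroup M G; K \<subseteq> L; L \<subseteq> M; r \<in> carrier (tval R K)\<rbrakk> \<Longrightarrow>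
        tnm R L M (tnm R K L r) = tnm R K M r"
    and cj_trans: "\<lbrakk>subgroup K G; g \<in> carrier G; h \<in> carrier G; r \<in> carrier (tval R K)\<rbrakk> \<Longrightarrow>
        tcj R h (conj_set G g K) (tcj R g K r) = tcj R (h \<otimes> g) K r"
    and cj_res: "\<lbrakk>subgroup K G; subgroup L G; K \<subseteq> L; g \<in> carrier G; r \<in> carrier (tval R L)\<rbrakk> \<Longrightarrow>
        tcj R g K (tres R K L r) = tres R (conj_set G g K) (conj_set G g L) (tcj R g L r)"
    and cj_tr: "\<lbrakk>subgroup K G; subgroup L G; K \<subseteq> L; g \<in> carrier G; r \<in> carrier (tval R K)\<rbrakk> \<Longrightarrow>
        tcj R g L (ttr R K L r) = ttr R (conj_set G g K) (conj_set G g L) (tcj R g K r)"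
    and cj_nm: "\<lbrakk>subgroup K G; subgroup L G; K \<subseteq> L; g \<in> carrier G; r \<in> carrier (tval R K)\<rbrakk> \<Longrightarrow>
        tcj R g L (tnm R K L r) = tnm R (conj_set G g K) (conj_set G g L) (tcj R g K r)"
    and base_change_tr:
      "\<And>(X :: ('g, 'g set \<times> nat) gset) (Y :: ('g, 'g set \<times> nat) gset) (Z :: ('g, 'g set \<times> nat) gset) f h s.
        \<lbrakk>finite_gset G X; finite_gset G Y; finite_gset G Z; gmap G X Y f; gmap G Z Y h;
         s \<in> ext_carrier G R X\<rbrakk> \<Longrightarrow>
        ext_res G R Z Y h (ext_tr G R X Y f s) =
        ext_tr G R (pullback X Z f h) Z snd (ext_res G R (pullback X Z f h) X fst s)"
    and base_change_nm:
      "\<And>(X :: ('g, 'g set \<times> nat) gset) (Y :: ('g, 'g set \<times> nat) gset) (Z :: ('g, 'g set \<times> nat) gset) f h s.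
        \<lbrakk>finite_gset G X; finite_gset G Y; finite_gset G Z; gmap G X Y f; gmap G Z Y h;
         s \<in> ext_carrier G R X\<rbrakk> \<Longrightarrow>
        ext_res G R Z Y h (ext_nm G R X Y f s) =
        ext_nm G R (pullback X Z f h) Z snd (ext_res G R (pullback X Z f h) X fst s)"
    and distributive:
      "\<And>(A :: ('g, 'g set \<times> nat) gset) (X :: ('g, 'g set \<times> nat) gset) (Y :: ('g, 'g set \<times> nat) gset) p f s.
        \<lbrakk>finite_gset G A; finite_gset G X; finite_gset G Y; gmap G A X p; gmap G X Y f;
         s \<in> ext_carrier G R A\<rbrakk> \<Longrightarrow>
        ext_nm G R X Y f (ext_tr G R A X p s) =
        (let D = dep_prod G A X Y p f; E = pullback X D f fst
         in ext_tr G R D Y fst (ext_nm G R E D snd (ext_res G R E A (\<lambda>(x, y, t). t x) s)))"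


section \<open>Tambara ideals and the Nakaoka spectrum\<close>

text \<open>A collection of ideals is a function on subgroups, taken to be empty elsewhere so that
  equal collections are equal functions. Inclusion of collections is the order \<open>\<le>\<close> on functions.\<close>

definition tambara_ideal :: "('g, 'm) monoid_scheme \<Rightarrow> ('g, 'r) tambara \<Rightarrow> ('g set \<Rightarrow> 'r set) \<Rightarrow> bool" where
  "tambara_ideal G R I \<longleftrightarrow>
     (\<forall>K. \<not> subgroup K G \<longrightarrow> I K = {}) \<and>
     (\<forall>K. subgroup K G \<longrightarrow> ideal (I K) (tval R K)) \<and>
     (\<forall>K L. subgroup K G \<longrightarrow> subgroup L G \<longrightarrow> K \<subseteq> L \<longrightarrow>
        ttr R K L ` I K \<subseteq> I L \<and> tnm R K L ` I K \<subseteq> I L \<and> tres R K L ` I L \<subseteq> I K) \<and>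
     (\<forall>K g. subgroup K G \<longrightarrow> g \<in> carrier G \<longrightarrow> tcj R g K ` I K \<subseteq> I (conj_set G g K))"

definition unit_ideal :: "('g, 'm) monoid_scheme \<Rightarrow> ('g, 'r) tambara \<Rightarrow> 'g set \<Rightarrow> 'r set" where
  "unit_ideal G R = (\<lambda>K. if subgroup K G then carrier (tval R K) else {})"

definition zero_ideal :: "('g, 'm) monoid_scheme \<Rightarrow> ('g, 'r) tambara \<Rightarrow> 'g set \<Rightarrow> 'r set" where
  "zero_ideal G R = (\<lambda>K. if subgroup K G then {\<zero>\<^bsub>tval R K\<^esub>} else {})"

definition prod_ideal :: "('g, 'm) monoid_scheme \<Rightarrow> ('g, 'r) tambara
    \<Rightarrow> ('g set \<Rightarrow> 'r set) \<Rightarrow> ('g set \<Rightarrow> 'r set) \<Rightarrow> 'g set \<Rightarrow> 'r set" where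
  "prod_ideal G R I J = (\<lambda>K. \<Inter>Q\<in>{Q. tambara_ideal G R Q \<and>
       (\<forall>L. subgroup L G \<longrightarrow> I L \<cdot>\<^bsub>tval R L\<^esub> J L \<subseteq> Q L)}. Q K)"

definition prime_tambara_ideal :: "('g, 'm) monoid_scheme \<Rightarrow> ('g, 'r) tambara \<Rightarrow> ('g set \<Rightarrow> 'r set) \<Rightarrow> bool" where
  "prime_tambara_ideal G R p \<longleftrightarrow> tambara_ideal G R p \<and> p \<noteq> unit_ideal G R \<and>
     (\<forall>I J. tambara_ideal G R I \<longrightarrow> tambara_ideal G R J \<longrightarrow>
        prod_ideal G R I J \<le> p \<longrightarrow> I \<le> p \<or> J \<le> p)"

definition domain_like :: "('g, 'm) monoid_scheme \<Rightarrow> ('g, 'r) tambara \<Rightarrow> bool" where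
  "domain_like G R \<longleftrightarrow> prime_tambara_ideal G R (zero_ideal G R)"

definition Nak_Spec :: "('g, 'm) monoid_scheme \<Rightarrow> ('g, 'r) tambara \<Rightarrow> ('g set \<Rightarrow> 'r set) set" where
  "Nak_Spec G R = {p. prime_tambara_ideal G R p}"

definition Nak_V :: "('g, 'm) monoid_scheme \<Rightarrow> ('g, 'r) tambara \<Rightarrow> ('g set \<Rightarrow> 'r set) \<Rightarrow> ('g set \<Rightarrow> 'r set) set" where
  "Nak_V G R I = {p \<in> Nak_Spec G R. I \<le> p}"

definition Nak_topology :: "('g, 'm) monoid_scheme \<Rightarrow> ('g, 'r) tambara \<Rightarrow> ('g set \<Rightarrow> 'r set) topology" where
  "Nak_topology G R = topology (\<lambda>U. \<exists>I. tambara_ideal G R I \<and> U = Nak_Spec G R - Nak_V G R I)"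


text \<open>The sets \<open>V(I)\<close> are the closed sets of a topology, so \<open>openin\<close> has the intended meaning.\<close>

context tambara_functor begin

lemma subgroup_conj_set:
  "subgroup K G \<Longrightarrow> g \<in> carrier G \<Longrightarrow> subgroup (conj_set G g K) G"
  by (simp add: conj_set_def subgroup_conjugation_is_surj2)

lemma tambara_ideal_unit_ideal: "tambara_ideal G R (unit_ideal G R)"
  unfolding tambara_ideal_def unit_ideal_def
proof (intro conjI allI impI)
  fix K assume "subgroup K G"
  then show "ideal (if subgroup K G then carrier (tval R K) else {}) (tval R K)"
    using val_cring[of K] by (simp add: cring.axioms ring.oneideal)
next
  fix K L assume h: "subgroup K G" "subgroup L G" "K \<subseteq> L"
  show "ttr R K L ` (if subgroup K G then carrier (tval R K) else {})
      \<subseteq> (if subgroup L G then carrier (tval R L) else {})"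
    using h tr_hom[OF h] by (auto simp: hom_def)
  show "tnm R K L ` (if subgroup K G then carrier (tval R K) else {})
      \<subseteq> (if subgroup L G then carrier (tval R L) else {})"
    using h nm_hom[OF h] by (auto simp: hom_def)
  show "tres R K L ` (if subgroup L G then carrier (tval R L) else {})
      \<subseteq> (if subgroup K G then carrier (tval R K) else {})"
    using h res_hom[OF h] by (auto simp: ring_hom_def)
next
  fix K g assume h: "subgroup K G" "g \<in> carrier G"
  show "tcj R g K ` (if subgroup K G then carrier (tval R K) else {})
      \<subseteq> (if subgroup (conj_set G g K) G then carrier (tval R (conj_set G g K)) else {})"
    using h cj_hom[OF h] subgroup_conj_set[OF h] by (auto simp: ring_hom_def)
qed auto

lemma tambara_ideal_INT:
  assumes "F \<noteq> {}" and id: "\<And>I. I \<in> F \<Longrightarrow> tambara_ideal G R I"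
  shows "tambara_ideal G R (\<lambda>K. \<Inter>I\<in>F. I K)"
  unfolding tambara_ideal_def
proof (intro conjI allI impI)
  fix K assume "\<not> subgroup K G"
  then have "\<And>I. I \<in> F \<Longrightarrow> I K = {}" using id by (simp add: tambara_ideal_def)
  then show "(\<Inter>I\<in>F. I K) = {}" using \<open>F \<noteq> {}\<close> by auto
next
  fix K assume K: "subgroup K G"
  interpret cring "tval R K" by (rule val_cring[OF K])
  have "ideal (\<Inter>((\<lambda>I. I K) ` F)) (tval R K)"
    by (rule i_Intersect) (use assms K in \<open>auto simp: tambara_ideal_def\<close>)
  then show "ideal (\<Inter>I\<in>F. I K) (tval R K)" by simp
next
  fix K L assume h: "subgroup K G" "subgroup L G" "K \<subseteq> L"
  have *: "ttr R K L ` I K \<subseteq> I L \<and> tnm R K L ` I K \<subseteq> I L \<and> tres R K L ` I L \<subseteq> I K" if "I \<in> F" for I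
    using id[OF that] h by (simp add: tambara_ideal_def)
  show "ttr R K L ` (\<Inter>I\<in>F. I K) \<subseteq> (\<Inter>I\<in>F. I L)"
    "tnm R K L ` (\<Inter>I\<in>F. I K) \<subseteq> (\<Inter>I\<in>F. I L)"
    "tres R K L ` (\<Inter>I\<in>F. I L) \<subseteq> (\<Inter>I\<in>F. I K)"
    using * by blast+
next
  fix K g assume h: "subgroup K G" "g \<in> carrier G"
  have *: "tcj R g K ` I K \<subseteq> I (conj_set G g K)" if "I \<in> F" for I
    using id[OF that] h by (simp add: tambara_ideal_def)
  then show "tcj R g K ` (\<Inter>I\<in>F. I K) \<subseteq> (\<Inter>I\<in>F. I (conj_set G g K))"
    by blast
qed

lemma prod_ideal_least:
  assumes "tambara_ideal G R Q" "\<And>L. subgroup L G \<Longrightarrow> I L \<cdot>\<^bsub>tval R L\<^esub> J L \<subseteq> Q L"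
  shows "prod_ideal G R I J \<le> Q"
  using assms by (auto simp: prod_ideal_def le_fun_def)

lemma tambara_ideal_prod_ideal:
  assumes "tambara_ideal G R I" "tambara_ideal G R J"
  shows "tambara_ideal G R (prod_ideal G R I J)"
  unfolding prod_ideal_def
proof (rule tambara_ideal_INT)
  have "I L \<cdot>\<^bsub>tval R L\<^esub> J L \<subseteq> unit_ideal G R L" if L: "subgroup L G" for L
  proof -
    interpret cring "tval R L" by (rule val_cring[OF L])
    show ?thesis
      using ideal_prod_in_carrier[of "I L" "J L"] assms L
      by (simp add: tambara_ideal_def unit_ideal_def)
  qed
  then show "{Q. tambara_ideal G R Q \<and> (\<forall>L. subgroup L G \<longrightarrow> I L \<cdot>\<^bsub>tval R L\<^esub> J L \<subseteq> Q L)} \<noteq> {}"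
    using tambara_ideal_unit_ideal by blast
qed simp

lemma istopology_Nak:
  "istopology (\<lambda>U. \<exists>I. tambara_ideal G R I \<and> U = Nak_Spec G R - Nak_V G R I)"
  unfolding istopology_def
proof (intro conjI allI impI)
  fix S T
  assume "\<exists>I. tambara_ideal G R I \<and> S = Nak_Spec G R - Nak_V G R I"
    "\<exists>I. tambara_ideal G R I \<and> T = Nak_Spec G R - Nak_V G R I"
  then obtain I J where I: "tambara_ideal G R I" "S = Nak_Spec G R - Nak_V G R I"
    and J: "tambara_ideal G R J" "T = Nak_Spec G R - Nak_V G R J" by blast
  have sub: "I L \<cdot>\<^bsub>tval R L\<^esub> J L \<subseteq> I L \<inter> J L" if L: "subgroup L G" for L
  proof -
    interpret cring "tval R L" by (rule val_cring[OF L])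
    show ?thesis using ideal_prod_inter[of "I L" "J L"] I J L by (simp add: tambara_ideal_def)
  qed
  have "prod_ideal G R I J \<le> I" "prod_ideal G R I J \<le> J"
    using sub I J by (auto intro!: prod_ideal_least)
  then have "Nak_V G R (prod_ideal G R I J) = Nak_V G R I \<union> Nak_V G R J"
    using I J unfolding Nak_V_def Nak_Spec_def prime_tambara_ideal_def
    by (auto intro: order_trans)
  then show "\<exists>I. tambara_ideal G R I \<and> S \<inter> T = Nak_Spec G R - Nak_V G R I"
    using I J tambara_ideal_prod_ideal[of I J] by blast
next
  fix \<U> :: "('g set \<Rightarrow> 'r set) set set"
  assume "\<forall>U\<in>\<U>. \<exists>I. tambara_ideal G R I \<and> U = Nak_Spec G R - Nak_V G R I"
  then obtain I where I: "\<And>U. U \<in> \<U> \<Longrightarrow> tambara_ideal G R (I U)"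
    "\<And>U. U \<in> \<U> \<Longrightarrow> U = Nak_Spec G R - Nak_V G R (I U)" by metis
  define F where "F = {Q. tambara_ideal G R Q \<and> (\<forall>U\<in>\<U>. I U \<le> Q)}"
  define J where "J = (\<lambda>K. \<Inter>Q\<in>F. Q K)"
  have "I U \<le> unit_ideal G R" if "U \<in> \<U>" for U
  proof (rule le_funI)
    fix K
    show "I U K \<le> unit_ideal G R K"
    proof (cases "subgroup K G")
      case True
      then have "ideal (I U K) (tval R K)" using I(1)[OF that] by (simp add: tambara_ideal_def)
      then show ?thesis
        using True ideal.Icarr by (fastforce simp: unit_ideal_def)
    qed (use I(1)[OF that] in \<open>simp add: tambara_ideal_def\<close>)
  qed
  then have "F \<noteq> {}" using tambara_ideal_unit_ideal by (auto simp: F_def)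
  then have J: "tambara_ideal G R J"
    unfolding J_def by (rule tambara_ideal_INT) (simp add: F_def)
  have "J \<le> p \<longleftrightarrow> (\<forall>U\<in>\<U>. I U \<le> p)" if "p \<in> Nak_Spec G R" for p
  proof
    assume "J \<le> p"
    moreover have "I U \<le> J" if "U \<in> \<U>" for U
      using that by (fastforce simp: J_def F_def le_fun_def)
    ultimately show "\<forall>U\<in>\<U>. I U \<le> p" by (meson order_trans)
  next
    assume "\<forall>U\<in>\<U>. I U \<le> p"
    then have "p \<in> F" using that by (simp add: F_def Nak_Spec_def prime_tambara_ideal_def)
    then show "J \<le> p" by (auto simp: J_def le_fun_def)
  qed
  then have "\<Union>\<U> = Nak_Spec G R - Nak_V G R J"
    using I(2) by (auto simp: Nak_V_def)
  with J show "\<exists>I. tambara_ideal G R I \<and> \<Union>\<U> = Nak_Spec G R - Nak_V G R I" by blast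
qed

lemma openin_Nak_topology:
  "openin (Nak_topology G R) U \<longleftrightarrow> (\<exists>I. tambara_ideal G R I \<and> U = Nak_Spec G R - Nak_V G R I)"
  using topology_inverse'[OF istopology_Nak] by (simp add: Nak_topology_def)

end


section \<open>Restriction, coinduction and strata\<close>

text \<open>\<open>Res\<^sub>H R\<close> has \<open>H/L \<mapsto> R(G/L)\<close>. As the data are indexed by subgroups, these are the same data,
  now read over the group \<open>G\<lparr>carrier := H\<rparr>\<close>, i.e. only at subgroups of \<open>H\<close>.\<close>

definition Res_tambara :: "'g set \<Rightarrow> ('g, 'r) tambara \<Rightarrow> ('g, 'r) tambara" where
  "Res_tambara H R = R"

text \<open>\<open>CoInd S (G/K) = S(Res\<^sub>H (G/K))\<close>; all structure maps are those of \<open>S\<close> along the maps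
  \<open>G/K \<rightarrow> G/L, xK \<mapsto> xL\<close> and \<open>G/gKg\<^sup>-\<^sup>1 \<rightarrow> G/K, x gKg\<^sup>-\<^sup>1 \<mapsto> xgK\<close>, regarded as \<open>H\<close>-maps.
  This is the target of the unit \<open>CoInd_unit\<close> below.\<close>

definition CoInd_tambara :: "('g, 'm) monoid_scheme \<Rightarrow> 'g set \<Rightarrow> ('g, 'r) tambara \<Rightarrow> ('g, 'g set \<Rightarrow> 'r) tambara" where
  "CoInd_tambara G H S =
     (let GH = G\<lparr>carrier := H\<rparr>; cos = coset_gset G in
      \<lparr>tval = (\<lambda>K. ext_ring GH S (cos K)),
       tres = (\<lambda>K L. ext_res GH S (cos K) (cos L) (\<lambda>C. C <#>\<^bsub>G\<^esub> L)),
       ttr = (\<lambda>K L. ext_tr GH S (cos K) (cos L) (\<lambda>C. C <#>\<^bsub>G\<^esub> L)),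
       tnm = (\<lambda>K L. ext_nm GH S (cos K) (cos L) (\<lambda>C. C <#>\<^bsub>G\<^esub> L)),
       tcj = (\<lambda>g K. ext_res GH S (cos (conj_set G g K)) (cos K) (\<lambda>C. C #>\<^bsub>G\<^esub> g))\<rparr>)"

definition ext_ideal :: "('g, 'm) monoid_scheme \<Rightarrow> ('g, 'r) tambara \<Rightarrow> ('g set \<Rightarrow> 'r set) \<Rightarrow> ('g, 'x) gset \<Rightarrow> ('x \<Rightarrow> 'r) set" where
  "ext_ideal G R I X = {s \<in> ext_carrier G R X. \<forall>x\<in>pts X. s x \<in> I (stab G X x)}"

definition CoInd_ideal :: "('g, 'm) monoid_scheme \<Rightarrow> 'g set \<Rightarrow> ('g, 'r) tambara \<Rightarrow> ('g set \<Rightarrow> 'r set)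
    \<Rightarrow> 'g set \<Rightarrow> ('g set \<Rightarrow> 'r) set" where
  "CoInd_ideal G H S I =
     (\<lambda>K. if subgroup K G then ext_ideal (G\<lparr>carrier := H\<rparr>) S I (coset_gset G K) else {})"

text \<open>The identification of \<open>R(G/K)\<close> with its description by families: the value at the coset
  \<open>gK\<close> (with stabilizer \<open>gKg\<^sup>-\<^sup>1\<close>) is the conjugate by \<open>g\<close>, for any \<open>g\<close> in the coset.\<close>

definition orbit_family :: "('g, 'm) monoid_scheme \<Rightarrow> ('g, 'r) tambara \<Rightarrow> 'g set \<Rightarrow> 'r \<Rightarrow> 'g set \<Rightarrow> 'r" where
  "orbit_family G R K r = (\<lambda>C\<in>pts (coset_gset G K). tcj R (SOME g. g \<in> C) K r)"

text \<open>The unit of the adjunction at \<open>X = G/K\<close> is restriction along the counit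
  \<open>G \<times>\<^sub>H X \<rightarrow> X, [g, x] \<mapsto> gx\<close>. In terms of families, \<open>R(G \<times>\<^sub>H X)\<close> consists of families
  \<open>s x \<in> R(G/H\<^sub>x)\<close>, \<open>x \<in> X\<close>, and the unit restricts each component from \<open>G\<^sub>x\<close> to \<open>H\<^sub>x\<close>.\<close>

definition CoInd_unit :: "('g, 'm) monoid_scheme \<Rightarrow> 'g set \<Rightarrow> ('g, 'r) tambara \<Rightarrow> 'g set \<Rightarrow> 'r \<Rightarrow> 'g set \<Rightarrow> 'r" where
  "CoInd_unit G H R K r =
     (let X = coset_gset G K in
      (\<lambda>x\<in>pts X. tres R (stab (G\<lparr>carrier := H\<rparr>) X x) (stab G X x) (orbit_family G R K r x)))"

definition preimage_ideal :: "('g, 'm) monoid_scheme \<Rightarrow> ('g, 'r) tambara \<Rightarrow> ('g set \<Rightarrow> 'r \<Rightarrow> 's)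
    \<Rightarrow> ('g set \<Rightarrow> 's set) \<Rightarrow> 'g set \<Rightarrow> 'r set" where
  "preimage_ideal G R \<phi> J = (\<lambda>K. if subgroup K G then {r \<in> carrier (tval R K). \<phi> K r \<in> J K} else {})"

definition stratum :: "('g, 'm) monoid_scheme \<Rightarrow> 'g set \<Rightarrow> ('g, 'r) tambara \<Rightarrow> ('g set \<Rightarrow> 'r set) set" where
  "stratum G H R =
     (\<lambda>q. preimage_ideal G R (CoInd_unit G H R) (CoInd_ideal G H (Res_tambara H R) q))
       ` Nak_Spec (G\<lparr>carrier := H\<rparr>) (Res_tambara H R)"

end

theory Submission
  imports Defs "HOL-Algebra.Ring_Divisibility"
begin

text \<open>Since \<open>R\<close> is domain-like, the zero ideal is a generic point: it lies in every nonempty open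
  set. It is not in the \<open>H\<close>th stratum, because a nonzero element of the kernel of
  \<open>R(G/G) \<rightarrow> R(G/H)\<close> lies in every \<open>\<eta>\<^sup>-\<^sup>1(CoInd q)\<close>. It remains to see that the stratum is not empty.
  The underlying ring \<open>R(G/e)\<close> is nonzero, for otherwise \<open>1 = N(1) = N(0) = 0\<close> at every level. If
  \<open>P\<close> is a maximal ideal of it, the elements \<open>r \<in> R(G/L)\<close>, \<open>L \<subseteq> H\<close>, all of whose conjugates
  \<open>h \<cdot> res r \<in> R(G/e)\<close>, \<open>h \<in> H\<close>, lie in \<open>P\<close> form a prime Tambara ideal of \<open>Res\<^sub>H R\<close>; closure
  under transfers and norms is the double coset formula at the trivial subgroup.\<close>

section \<open>Preliminaries on commutative rings and monoids\<close>

lemma (in cring) exists_maximalideal: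
  assumes "\<one> \<noteq> \<zero>"
  shows "\<exists>P. maximalideal P R"
proof -
  let ?A = "{I. ideal I R \<and> \<one> \<notin> I}"
  \<comment> \<open>Zorn's lemma on the ideals avoiding \<open>\<one>\<close>; a union of a nonempty
    chain of them is an ideal that still avoids \<open>\<one>\<close>.\<close>
  have "\<exists>M\<in>?A. \<forall>X\<in>?A. M \<subseteq> X \<longrightarrow> X = M"
  proof (rule subset_Zorn_nonempty)
    show "?A \<noteq> {}" using zeroideal assms by auto
  next
    fix C assume C: "C \<noteq> {}" "subset.chain ?A C"
    then have "subset.chain {I. ideal I R} C" by (auto simp: pred_on.chain_def)
    from chain_Union_is_ideal[OF this] C show "\<Union>C \<in> ?A"
      by (auto simp: pred_on.chain_def)
  qed
  then obtain M where M: "ideal M R" "\<one> \<notin> M"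
    and max: "\<And>J. ideal J R \<Longrightarrow> \<one> \<notin> J \<Longrightarrow> M \<subseteq> J \<Longrightarrow> J = M" by blast
  have "maximalideal M R"
  proof (rule maximalidealI)
    show "carrier R \<noteq> M" using M by auto
    fix J assume "ideal J R" "M \<subseteq> J"
    then show "J = M \<or> J = carrier R" using max ideal.one_imp_carrier by blast
  qed (rule M)
  then show ?thesis ..
qed

lemma ideal_vimage_hom:
  assumes "cring A" "cring B" "f \<in> ring_hom A B" "ideal J B"
  shows "ideal {r \<in> carrier A. f r \<in> J} A"
proof -
  interpret ring_hom_ring A B f
    using assms by (intro ring_hom_ringI2) (auto simp: cring.axioms)
  show ?thesis using ideal_vimage[OF assms(4)] .
qed

text \<open>Since \<open>A\<close> is nonempty, the product can be built from its first factor, so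
  the unit may lie outside \<open>S\<close>. This lets \<open>S\<close> be a proper ideal for
  products as well as for sums.\<close>

lemma (in comm_monoid) finprod_mem_nonempty:
  assumes "finite A" "A \<noteq> {}" "S \<subseteq> carrier G" "\<And>a b. a \<in> S \<Longrightarrow> b \<in> S \<Longrightarrow> a \<otimes> b \<in> S"
    and "\<And>a. a \<in> A \<Longrightarrow> f a \<in> S"
  shows "finprod G f A \<in> S"
  using assms(1,2,5)
proof (induction rule: finite_ne_induct)
  case (singleton x)
  then show ?case using assms(3) by (auto simp: subset_iff)
next
  case (insert x F)
  then have "f x \<in> carrier G" "f \<in> F \<rightarrow> carrier G" using assms(3) by auto
  then show ?case using insert assms(4) by simp
qed


section \<open>Coset spaces as \<open>G\<close>-sets\<close>

text \<open>The tag \<open>0\<close> only serves to land in the point type of the base change axioms.\<close>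

definition lcoset_gset :: "('g, 'm) monoid_scheme \<Rightarrow> 'g set \<Rightarrow> ('g, 'g set \<times> nat) gset" where
  "lcoset_gset G K = \<lparr>pts = (lcosets\<^bsub>G\<^esub> K) \<times> {0},
     act = (\<lambda>g. \<lambda>x\<in>(lcosets\<^bsub>G\<^esub> K) \<times> {0}. (g <#\<^bsub>G\<^esub> fst x, 0))\<rparr>"

text \<open>The projection from \<open>G/K\<close> to \<open>G/L\<close> for
  \<open>K \<subseteq> L\<close>, written with a product of sets so that no representative is
  chosen.\<close>

definition lcoset_map :: "('g, 'm) monoid_scheme \<Rightarrow> 'g set \<Rightarrow> 'g set \<times> nat \<Rightarrow> 'g set \<times> nat" where
  "lcoset_map G L = (\<lambda>x. (fst x <#>\<^bsub>G\<^esub> L, 0))"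

context group begin

lemma pts_lcoset_gset: "pts (lcoset_gset G K) = {(g <# K, 0) |g. g \<in> carrier G}"
  by (auto simp: lcoset_gset_def LCOSETS_def)

lemma act_lcoset_gset:
  assumes "subgroup K G" "a \<in> carrier G" "g \<in> carrier G"
  shows "act (lcoset_gset G K) a (g <# K, 0) = ((a \<otimes> g) <# K, 0)"
  using assms by (auto simp: lcoset_gset_def LCOSETS_def lcos_m_assoc subgroup.subset)

lemma lcos_eq_iff:
  assumes "subgroup K G" "a \<in> carrier G" "b \<in> carrier G"
  shows "(a <# K) = (b <# K) \<longleftrightarrow> inv a \<otimes> b \<in> K"
proof -
  interpret subgroup K G by fact
  have "b \<in> a <# K \<longleftrightarrow> inv a \<otimes> b \<in> K"
    using assms lcos_module_imp[OF is_group, of a b] lcos_module_rev[OF is_group, of a b] by blast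
  then show ?thesis
    using assms l_repr_independence[of b a K] lcos_self[of b K] by auto
qed

lemma conj_set_eq:
  assumes "subgroup K G" "g \<in> carrier G"
  shows "conj_set G g K = {a \<in> carrier G. inv g \<otimes> a \<otimes> g \<in> K}"
proof (intro equalityI subsetI)
  fix a assume "a \<in> conj_set G g K"
  then obtain k where "k \<in> K" and a: "a = g \<otimes> k \<otimes> inv g"
    by (auto simp: conj_set_def l_coset_def r_coset_def)
  moreover from this have k: "k \<in> carrier G" using assms subgroup.mem_carrier by metis
  moreover have "inv g \<otimes> a \<otimes> g = k"
    unfolding a using k assms by (simp add: m_assoc inv_solve_left')
  ultimately show "a \<in> {a \<in> carrier G. inv g \<otimes> a \<otimes> g \<in> K}" using assms by auto
next
  fix a assume a: "a \<in> {a \<in> carrier G. inv g \<otimes> a \<otimes> g \<in> K}"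
  then have "a = g \<otimes> (inv g \<otimes> a \<otimes> g) \<otimes> inv g"
    using assms by (simp add: m_assoc[symmetric]) (simp add: m_assoc)
  with a show "a \<in> conj_set G g K"
    by (auto simp: conj_set_def l_coset_def r_coset_def)
qed

lemma conj_set_same:
  assumes "subgroup L G" "g \<in> L"
  shows "conj_set G g L = L"
proof -
  interpret subgroup L G by fact
  show ?thesis
  proof (intro equalityI subsetI)
    fix a assume "a \<in> L"
    then show "a \<in> conj_set G g L" using assms by (simp add: conj_set_eq)
  next
    fix a assume "a \<in> conj_set G g L"
    then show "a \<in> L" using assms by (auto simp: conj_set_def l_coset_def r_coset_def)
  qed
qed

lemma conj_set_trivial: "g \<in> carrier G \<Longrightarrow> conj_set G g {\<one>} = {\<one>}"
  by (simp add: conj_set_def l_coset_def r_coset_def)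

text \<open>By the coset criterion, \<open>a\<close> fixes the coset of \<open>g\<close> exactly
  when \<open>inv g \<otimes> a \<otimes> g\<close> lies in \<open>K\<close>.\<close>

lemma stab_lcoset_gset:
  assumes "subgroup K G" "g \<in> carrier G"
  shows "stab G (lcoset_gset G K) (g <# K, 0) = conj_set G g K"
proof -
  have "act (lcoset_gset G K) a (g <# K, 0) = (g <# K, 0) \<longleftrightarrow> inv g \<otimes> a \<otimes> g \<in> K"
    if "a \<in> carrier G" for a
  proof -
    have "act (lcoset_gset G K) a (g <# K, 0) = (g <# K, 0) \<longleftrightarrow> (g <# K) = (a \<otimes> g) <# K"
      using assms that by (auto simp: act_lcoset_gset)
    also have "\<dots> \<longleftrightarrow> inv g \<otimes> a \<otimes> g \<in> K"
      using assms that by (simp add: lcos_eq_iff m_assoc)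
    finally show ?thesis .
  qed
  then show ?thesis using assms by (auto simp: stabilizer_def conj_set_eq)
qed

text \<open>\<open>BijGroup\<close> consists of extensional maps, hence the restricted abstraction
  in \<open>lcoset_gset\<close>. Bijectivity comes from the action of \<open>inv g\<close>, once the
  composition and unit laws hold on points.\<close>

lemma group_action_lcoset_gset:
  assumes "subgroup K G"
  shows "group_action G (pts (lcoset_gset G K)) (act (lcoset_gset G K))"
proof -
  let ?X = "lcoset_gset G K"
  have ext: "act ?X g \<in> extensional (pts ?X)" for g
    by (simp add: lcoset_gset_def)
  have closed: "act ?X g x \<in> pts ?X" if "g \<in> carrier G" "x \<in> pts ?X" for g x
    using that assms by (fastforce simp: pts_lcoset_gset act_lcoset_gset)
  have comp: "act ?X g (act ?X h x) = act ?X (g \<otimes> h) x"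
    if "g \<in> carrier G" "h \<in> carrier G" "x \<in> pts ?X" for g h x
    using that assms by (auto simp: pts_lcoset_gset act_lcoset_gset m_assoc)
  have one: "act ?X \<one> x = x" if "x \<in> pts ?X" for x
    using that assms by (auto simp: pts_lcoset_gset act_lcoset_gset)
  have bij: "act ?X g \<in> Bij (pts ?X)" if g: "g \<in> carrier G" for g
  proof -
    have "bij_betw (act ?X g) (pts ?X) (pts ?X)"
      by (rule bij_betw_byWitness[where f' = "act ?X (inv g)"])
        (use g closed in \<open>auto simp: comp one image_subset_iff\<close>)
    then show ?thesis using ext by (simp add: Bij_def)
  qed
  have "act ?X (g \<otimes> h) = compose (pts ?X) (act ?X g) (act ?X h)"
    if "g \<in> carrier G" "h \<in> carrier G" for g h
    using that ext[of "g \<otimes> h"] by (intro extensionalityI[of _ "pts ?X"]) (auto simp: compose_def comp)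
  then have "act ?X \<in> hom G (BijGroup (pts ?X))"
    using bij by (auto simp: hom_def BijGroup_def)
  then show ?thesis
    using group_BijGroup is_group by (simp add: group_action_def group_hom_def group_hom_axioms_def)
qed

lemma finite_gset_lcoset_gset:
  assumes "subgroup K G" "finite (carrier G)"
  shows "finite_gset G (lcoset_gset G K)"
  using assms group_action_lcoset_gset
  by (simp add: finite_gset_def pts_lcoset_gset)

text \<open>Associativity of set products reduces this to \<open>K <#> L = L\<close>, which holds
  because \<open>K\<close> contains \<open>\<one>\<close> and lies in \<open>L\<close>.\<close>

lemma lcoset_map_lcos:
  assumes "subgroup K G" "subgroup L G" "K \<subseteq> L" "g \<in> carrier G"
  shows "lcoset_map G L (g <# K, n) = (g <# L, 0)"
proof -
  interpret L: subgroup L G by fact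
  have "K <#> L = L"
  proof (intro equalityI subsetI)
    fix x assume "x \<in> K <#> L"
    then show "x \<in> L" using assms by (auto simp: set_mult_def)
  next
    fix x assume "x \<in> L"
    then have "x = \<one> \<otimes> x" by simp
    then show "x \<in> K <#> L"
      using \<open>x \<in> L\<close> subgroup.one_closed[OF assms(1)] unfolding set_mult_def by blast
  qed
  then show ?thesis
    using setmult_lcos_assoc[of K L g] assms by (simp add: lcoset_map_def subgroup.subset)
qed

lemma gmap_lcoset_map:
  assumes "subgroup K G" "subgroup L G" "K \<subseteq> L"
  shows "gmap G (lcoset_gset G K) (lcoset_gset G L) (lcoset_map G L)"
  using assms by (auto simp: gmap_def pts_lcoset_gset act_lcoset_gset lcoset_map_lcos)

lemma lcoset_one: "subgroup L G \<Longrightarrow> \<one> <# L = L"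
  by (simp add: lcos_mult_one subgroup.subset)

end

text \<open>Only the trivial group acts on the fibre over \<open>z\<close>, so every orbit there is
  a single point; and whatever fixes \<open>(x, z)\<close> fixes \<open>z\<close>.\<close>

lemma fibre_orbits_pullback_free:
  assumes X: "finite_gset G X" and Z: "finite_gset G Z" and z: "z \<in> pts Z" and st: "stab G Z z = {\<one>\<^bsub>G\<^esub>}"
  shows "fibre_orbits G (pullback X Z f h) Z snd z = (\<lambda>x. {(x, z)}) ` {x \<in> pts X. f x = h z}"
    and "x \<in> pts X \<Longrightarrow> f x = h z \<Longrightarrow> stab G (pullback X Z f h) (x, z) = {\<one>\<^bsub>G\<^esub>}"
proof -
  interpret X: group_action G "pts X" "act X" using X by (simp add: finite_gset_def)
  interpret Z: group_action G "pts Z" "act Z" using Z by (simp add: finite_gset_def)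
  interpret group G using X.group_hom by (simp add: group_hom_def)
  let ?P = "pullback X Z f h"
  have one: "act ?P \<one>\<^bsub>G\<^esub> (x, z) = (x, z)" if "x \<in> pts X" "f x = h z" for x
    using that z fun_cong[OF X.id_eq_one, of x] fun_cong[OF Z.id_eq_one, of z]
    by (simp add: pullback_def Let_def)
  have fib: "{w \<in> pts ?P. snd w = z} = (\<lambda>x. (x, z)) ` {x \<in> pts X. f x = h z}"
    using z by (auto simp: pullback_def Let_def)
  show "fibre_orbits G ?P Z snd z = (\<lambda>x. {(x, z)}) ` {x \<in> pts X. f x = h z}"
  proof -
    have "orbit (G\<lparr>carrier := {\<one>\<^bsub>G\<^esub>}\<rparr>) (act ?P) (x, z) = {(x, z)}" if "x \<in> pts X" "f x = h z" for x
      using one[OF that] by (simp add: orbit_def)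
    then show ?thesis unfolding fibre_orbits_def fib orbits_def st by force
  qed
  show "stab G ?P (x, z) = {\<one>\<^bsub>G\<^esub>}" if x: "x \<in> pts X" "f x = h z"
  proof -
    have "g = \<one>\<^bsub>G\<^esub>" if "g \<in> carrier G" "act ?P g (x, z) = (x, z)" for g
      using that x z st by (auto simp: pullback_def Let_def stabilizer_def)
    then show ?thesis using one[OF x] by (auto simp: stabilizer_def)
  qed
qed

section \<open>Families on coset spaces and a common form of transfers and norms\<close>

text \<open>\<open>orbit_family\<close> carried over to the tagged cosets: the element of the
  extension that corresponds to \<open>r\<close>.\<close>

definition lcoset_family :: "('g, 'm) monoid_scheme \<Rightarrow> ('g, 'r) tambara \<Rightarrow> 'g set \<Rightarrow> 'r \<Rightarrow> 'g set \<times> nat \<Rightarrow> 'r" where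
  "lcoset_family G R K r = (\<lambda>x\<in>pts (lcoset_gset G K). tcj R (SOME g. g \<in> fst x) K r)"

text \<open>Transfers and norms have the same shape: a fold, in the additive or the multiplicative
  monoid, over the orbits in a fibre. With \<open>M\<close> and \<open>T\<close> as parameters the
  double coset argument is carried out once for both.\<close>

definition ext_fold :: "('g, 'm) monoid_scheme \<Rightarrow> ('g set \<Rightarrow> ('r, 'k) monoid_scheme)
    \<Rightarrow> ('g set \<Rightarrow> 'g set \<Rightarrow> 'r \<Rightarrow> 'r) \<Rightarrow> ('g, 'x) gset \<Rightarrow> ('g, 'y) gset
    \<Rightarrow> ('x \<Rightarrow> 'y) \<Rightarrow> ('x \<Rightarrow> 'r) \<Rightarrow> 'y \<Rightarrow> 'r" where
  "ext_fold G M T X Y f s = (\<lambda>y\<in>pts Y.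
     finprod (M (stab G Y y))
       (\<lambda>orb. let x = (SOME x. x \<in> orb) in T (stab G X x) (stab G Y y) (s x))
       (fibre_orbits G X Y f y))"

lemma ext_tr_eq_ext_fold: "ext_tr G R = ext_fold G (\<lambda>K. add_monoid (tval R K)) (ttr R)"
  by (simp add: ext_tr_def ext_fold_def finsum_def fun_eq_iff)

lemma ext_nm_eq_ext_fold: "ext_nm G R = ext_fold G (tval R) (tnm R)"
  by (simp add: ext_nm_def ext_fold_def fun_eq_iff)

context group begin

lemma lcoset_gset_base:
  assumes "subgroup L G"
  shows "(L, 0) \<in> pts (lcoset_gset G L)" "stab G (lcoset_gset G L) (L, 0) = L"
  using assms lcoset_one[of L] pts_lcoset_gset[of L] stab_lcoset_gset[of L \<one>]
    conj_set_same[of L \<one>] subgroup.one_closed[of L] by auto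

lemma lcoset_map_base:
  assumes "subgroup K G" "subgroup L G" "K \<subseteq> L"
  shows "lcoset_map G L (K, 0) = (L, 0)"
  using lcoset_map_lcos[OF assms one_closed, of 0] assms by (simp add: lcoset_one)

text \<open>A coset of \<open>g\<close> maps to the base coset exactly when
  \<open>g \<in> L\<close>, and \<open>L\<close> permutes these cosets transitively because right
  multiplication by an element of \<open>L\<close> maps \<open>L\<close> onto itself.\<close>

lemma fibre_orbits_lcoset_map:
  assumes K: "subgroup K G" and L: "subgroup L G" and KL: "K \<subseteq> L"
  shows "fibre_orbits G (lcoset_gset G K) (lcoset_gset G L) (lcoset_map G L) (L, 0) =
    {(\<lambda>g. (g <# K, 0)) ` L}"
    and "{x \<in> pts (lcoset_gset G K). lcoset_map G L x = (L, 0)} = (\<lambda>g. (g <# K, 0)) ` L"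
proof -
  interpret L: subgroup L G by fact
  note st = lcoset_gset_base(2)[OF L]
  have coset: "(g <# L) = L \<longleftrightarrow> g \<in> L" if "g \<in> carrier G" for g
    using lcos_eq_iff[OF L one_closed that] that lcoset_one[OF L] by auto
  show fib: "{x \<in> pts (lcoset_gset G K). lcoset_map G L x = (L, 0)} = (\<lambda>g. (g <# K, 0)) ` L"
    using coset by (auto simp: pts_lcoset_gset lcoset_map_lcos[OF K L KL])
  have orb: "orbit (G\<lparr>carrier := L\<rparr>) (act (lcoset_gset G K)) (g <# K, 0) = (\<lambda>g. (g <# K, 0)) ` L"
    if g: "g \<in> L" for g
  proof -
    have "orbit (G\<lparr>carrier := L\<rparr>) (act (lcoset_gset G K)) (g <# K, 0) =
        (\<lambda>a. act (lcoset_gset G K) a (g <# K, 0)) ` L"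
      by (auto simp: orbit_def)
    also have "\<dots> = (\<lambda>a. ((a \<otimes> g) <# K, 0)) ` L"
      using g by (intro image_cong) (simp_all add: act_lcoset_gset[OF K])
    also have "\<dots> = (\<lambda>g. (g <# K, 0)) ` ((\<lambda>a. a \<otimes> g) ` L)"
      by (simp add: image_image)
    also have "(\<lambda>a. a \<otimes> g) ` L = L"
    proof (intro equalityI subsetI)
      fix a assume "a \<in> L"
      then have "a = (a \<otimes> inv g) \<otimes> g" "a \<otimes> inv g \<in> L" using g by (simp_all add: m_assoc)
      then show "a \<in> (\<lambda>a. a \<otimes> g) ` L" by blast
    qed (use g in auto)
    finally show ?thesis .
  qed
  then show "fibre_orbits G (lcoset_gset G K) (lcoset_gset G L) (lcoset_map G L) (L, 0) =
    {(\<lambda>g. (g <# K, 0)) ` L}"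
  proof -
    let ?H = "G\<lparr>carrier := L\<rparr>" and ?a = "act (lcoset_gset G K)"
    have "orbits ?H ((\<lambda>g. (g <# K, 0)) ` L) ?a = (\<lambda>g. orbit ?H ?a (g <# K, 0)) ` L"
      by (auto simp: orbits_def)
    also have "\<dots> = (\<lambda>_. (\<lambda>g. (g <# K, 0)) ` L) ` L"
      using orb by (intro image_cong) simp_all
    also have "\<dots> = {(\<lambda>g. (g <# K, 0)) ` L}"
      using L.one_closed by (rule image_constant)
    finally show ?thesis unfolding fibre_orbits_def st fib .
  qed
qed

end


section \<open>Transfers and norms restricted to the trivial subgroup\<close>

context tambara_functor begin

lemma cj_closed: "\<lbrakk>subgroup K G; g \<in> carrier G; r \<in> carrier (tval R K)\<rbrakk> \<Longrightarrow>
    tcj R g K r \<in> carrier (tval R (conj_set G g K))"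
  by (rule ring_hom_closed[OF cj_hom])

lemma res_closed: "\<lbrakk>subgroup K G; subgroup L G; K \<subseteq> L; r \<in> carrier (tval R L)\<rbrakk> \<Longrightarrow>
    tres R K L r \<in> carrier (tval R K)"
  by (rule ring_hom_closed[OF res_hom])

lemma tr_closed: "\<lbrakk>subgroup K G; subgroup L G; K \<subseteq> L; r \<in> carrier (tval R K)\<rbrakk> \<Longrightarrow>
    ttr R K L r \<in> carrier (tval R L)"
  using hom_in_carrier[OF tr_hom] by simp

lemma nm_closed: "\<lbrakk>subgroup K G; subgroup L G; K \<subseteq> L; r \<in> carrier (tval R K)\<rbrakk> \<Longrightarrow>
    tnm R K L r \<in> carrier (tval R L)"
  by (rule hom_in_carrier[OF nm_hom])

text \<open>Two representatives of a coset differ by some \<open>k \<in> K\<close> on the right, and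
  conjugation by \<open>k\<close> is trivial on \<open>R(G/K)\<close>.\<close>

lemma lcoset_family_lcos:
  assumes K: "subgroup K G" and g: "g \<in> carrier G" and r: "r \<in> carrier (tval R K)"
  shows "lcoset_family G R K r (g <# K, 0) = tcj R g K r"
proof -
  let ?g = "SOME a. a \<in> g <# K"
  have "?g \<in> g <# K" using lcos_self[OF g K] by (rule someI)
  then obtain k where k: "k \<in> K" "?g = g \<otimes> k" by (auto simp: l_coset_def)
  then have "k \<in> carrier G" using K subgroup.mem_carrier by metis
  then have "tcj R ?g K r = tcj R g K r"
    using cj_trans[OF K _ g r, of k] cj_inner[OF K k(1) r] conj_set_same[OF K k(1)] k(2) by simp
  then show ?thesis using g by (auto simp: lcoset_family_def pts_lcoset_gset)
qed

lemma lcoset_family_ext_carrier: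
  assumes K: "subgroup K G" and r: "r \<in> carrier (tval R K)"
  shows "lcoset_family G R K r \<in> ext_carrier G R (lcoset_gset G K)"
proof -
  have "lcoset_family G R K r \<in> extensional (pts (lcoset_gset G K))"
    by (simp add: lcoset_family_def)
  moreover have "lcoset_family G R K r x \<in> carrier (tval R (stab G (lcoset_gset G K) x))"
    if "x \<in> pts (lcoset_gset G K)" for x
    using that assms by (auto simp: pts_lcoset_gset lcoset_family_lcos stab_lcoset_gset cj_closed)
  moreover have "lcoset_family G R K r (act (lcoset_gset G K) g x) =
      tcj R g (stab G (lcoset_gset G K) x) (lcoset_family G R K r x)"
    if "g \<in> carrier G" "x \<in> pts (lcoset_gset G K)" for g x
    using that assms
    by (auto simp: pts_lcoset_gset lcoset_family_lcos stab_lcoset_gset act_lcoset_gset cj_trans)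
  ultimately show ?thesis by (auto simp: ext_carrier_def PiE_def)
qed

text \<open>The fibre over the base coset is a single orbit, so the fold has one factor. The last
  assumption makes this factor independent of the representative picked by
  \<open>SOME\<close>.\<close>

lemma ext_fold_lcoset_map:
  assumes K: "subgroup K G" and L: "subgroup L G" and KL: "K \<subseteq> L" and r: "r \<in> carrier (tval R K)"
    and M: "comm_monoid (M L)" "T K L r \<in> carrier (M L)"
    and T: "\<And>g. g \<in> L \<Longrightarrow> T (conj_set G g K) L (tcj R g K r) = T K L r"
  shows "ext_fold G M T (lcoset_gset G K) (lcoset_gset G L) (lcoset_map G L) (lcoset_family G R K r) (L, 0)
    = T K L r"
proof -
  interpret M: comm_monoid "M L" by fact
  let ?F = "(\<lambda>g. (g <# K, 0::nat)) ` L"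
  have "\<one> \<in> L" using L by (rule subgroup.one_closed)
  then have "(SOME x. x \<in> ?F) \<in> ?F" by (intro someI_ex[of "\<lambda>x. x \<in> ?F"]) auto
  then obtain g where "g \<in> L" "(SOME x. x \<in> ?F) = (g <# K, 0)" by auto
  moreover from this have "g \<in> carrier G" using L subgroup.mem_carrier by metis
  ultimately have "(let x = SOME x. x \<in> ?F
      in T (stab G (lcoset_gset G K) x) L (lcoset_family G R K r x)) = T K L r"
    using K r T by (simp add: stab_lcoset_gset lcoset_family_lcos)
  then show ?thesis
    using M(2) lcoset_gset_base[OF L]
    by (simp add: ext_fold_def fibre_orbits_lcoset_map(1)[OF K L KL])
qed

text \<open>The \<open>G\<close>-set \<open>G/K \<times>\<^bsub>G/L\<^esub> G\<close> is free, so only conjugates of \<open>res r\<close> occur.\<close>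

lemma ext_fold_pullback_mem:
  assumes K: "subgroup K G" and L: "subgroup L G" and KL: "K \<subseteq> L" and r: "r \<in> carrier (tval R K)"
    and M: "comm_monoid (M {\<one>})" "S \<subseteq> carrier (M {\<one>})"
      "\<And>a b. a \<in> S \<Longrightarrow> b \<in> S \<Longrightarrow> a \<otimes>\<^bsub>M {\<one>}\<^esub> b \<in> S"
    and T: "\<And>a. a \<in> S \<Longrightarrow> T {\<one>} {\<one>} a = a"
    and S: "\<And>g. g \<in> L \<Longrightarrow> tcj R g {\<one>} (tres R {\<one>} K r) \<in> S"
  defines "X \<equiv> lcoset_gset G K" and "Z \<equiv> lcoset_gset G {\<one>}"
  defines "P \<equiv> pullback X Z (lcoset_map G L) (lcoset_map G L)"
  shows "ext_fold G M T P Z snd (ext_res G R P X fst (lcoset_family G R K r)) ({\<one>}, 0) \<in> S"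
proof -
  interpret M: comm_monoid "M {\<one>}" by fact
  define z where "z = ({\<one>}, 0::nat)"
  have e: "subgroup {\<one>} G" by (rule triv_subgroup)
  have eK: "{\<one>} \<subseteq> K" and eL: "{\<one>} \<subseteq> L" using K L subgroup.one_closed by auto
  have z: "z \<in> pts Z" "stab G Z z = {\<one>}" "lcoset_map G L z = (L, 0)"
    using lcoset_gset_base[OF e] lcoset_map_base[OF e L eL] by (simp_all add: z_def Z_def)
  have X: "finite_gset G X" and Z: "finite_gset G Z"
    using K e finite_group by (simp_all add: X_def Z_def finite_gset_lcoset_gset)
  \<comment> \<open>The identity coset \<open>z\<close> has trivial stabilizer, so the fold at
    \<open>z\<close> runs over the fibre \<open>?F\<close> itself, one factor per point.\<close>
  note free = fibre_orbits_pullback_free[OF X Z z(1,2),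
      where f = "lcoset_map G L" and h = "lcoset_map G L", folded P_def]
  let ?F = "{x \<in> pts X. lcoset_map G L x = (L, 0)}"
  have F: "?F = (\<lambda>g. (g <# K, 0)) ` L"
    unfolding X_def by (rule fibre_orbits_lcoset_map(2)[OF K L KL])
  have "finprod (M {\<one>}) (\<lambda>orb. let x = SOME x. x \<in> orb
      in T (stab G P x) {\<one>} (ext_res G R P X fst (lcoset_family G R K r) x))
    (fibre_orbits G P Z snd z) \<in> S"
    unfolding free(1) z(3)
  proof (rule M.finprod_mem_nonempty)
    show "finite ((\<lambda>x. {(x, z)}) ` ?F)" using X by (simp add: finite_gset_def)
    \<comment> \<open>The coset of \<open>\<one>\<close> is in the fibre.\<close>
    show "(\<lambda>x. {(x, z)}) ` ?F \<noteq> {}" unfolding F using L subgroup.one_closed by auto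
    fix orb assume "orb \<in> (\<lambda>x. {(x, z)}) ` ?F"
    then obtain x where x: "x \<in> ?F" and orb: "orb = {(x, z)}" by auto
    then obtain g where g: "g \<in> L" and xg: "x = (g <# K, 0)" unfolding F by auto
    then have gG: "g \<in> carrier G" using L subgroup.mem_carrier by metis
    have stP: "stab G P (x, z) = {\<one>}" using x z by (intro free(2)) auto
    have "(x, z) \<in> pts P" using x z by (auto simp: P_def pullback_def Let_def)
    then have "ext_res G R P X fst (lcoset_family G R K r) (x, z) =
        tres R (stab G P (x, z)) (stab G X x) (lcoset_family G R K r x)"
      by (simp add: ext_res_def)
    also have "\<dots> = tres R {\<one>} (conj_set G g K) (tcj R g K r)"
      unfolding stP using gG K r by (simp add: xg X_def stab_lcoset_gset lcoset_family_lcos)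
    \<comment> \<open>Conjugation commutes with restriction, and the trivial subgroup is its own
      conjugate.\<close>
    also have "\<dots> = tcj R g {\<one>} (tres R {\<one>} K r)"
      using cj_res[OF e K eK gG r] conj_set_trivial[OF gG] by simp
    finally show "(let x = SOME x. x \<in> orb
        in T (stab G P x) {\<one>} (ext_res G R P X fst (lcoset_family G R K r) x)) \<in> S"
      using S[OF g] T by (simp add: orb stP)
  qed (use M in auto)
  then show ?thesis using z by (simp add: ext_fold_def flip: z_def)
qed

text \<open>Base change along \<open>G/K \<rightarrow> G/L \<leftarrow> G/1\<close>, evaluated at
  the identity coset: one side is the restriction of \<open>T K L r\<close>, the other a fold of
  conjugates of the restriction of \<open>r\<close>. Only membership in a set \<open>S\<close>
  closed under the operation is recorded, which avoids writing the double coset formula out.\<close>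

lemma res_fold_mem:
  assumes K: "subgroup K G" and L: "subgroup L G" and KL: "K \<subseteq> L" and r: "r \<in> carrier (tval R K)"
    and M: "comm_monoid (M L)" "comm_monoid (M {\<one>})" "T K L r \<in> carrier (M L)"
    and S: "S \<subseteq> carrier (M {\<one>})" "\<And>a b. a \<in> S \<Longrightarrow> b \<in> S \<Longrightarrow> a \<otimes>\<^bsub>M {\<one>}\<^esub> b \<in> S"
      "\<And>g. g \<in> L \<Longrightarrow> tcj R g {\<one>} (tres R {\<one>} K r) \<in> S"
    and T: "\<And>g. g \<in> L \<Longrightarrow> T (conj_set G g K) L (tcj R g K r) = T K L r"
      "\<And>a. a \<in> S \<Longrightarrow> T {\<one>} {\<one>} a = a"
    and base_change: "\<And>(X :: ('g, 'g set \<times> nat) gset) (Y :: ('g, 'g set \<times> nat) gset)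
        (Z :: ('g, 'g set \<times> nat) gset) f h s.
        \<lbrakk>finite_gset G X; finite_gset G Y; finite_gset G Z; gmap G X Y f; gmap G Z Y h;
         s \<in> ext_carrier G R X\<rbrakk> \<Longrightarrow>
        ext_res G R Z Y h (ext_fold G M T X Y f s) =
        ext_fold G M T (pullback X Z f h) Z snd (ext_res G R (pullback X Z f h) X fst s)"
  shows "tres R {\<one>} L (T K L r) \<in> S"
proof -
  let ?X = "lcoset_gset G K" and ?Y = "lcoset_gset G L" and ?Z = "lcoset_gset G {\<one>}"
  let ?f = "lcoset_map G L" and ?z = "({\<one>}, 0::nat)" and ?s = "lcoset_family G R K r"
  have e: "subgroup {\<one>} G" by (rule triv_subgroup)
  have eL: "{\<one>} \<subseteq> L" using L subgroup.one_closed by auto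
  have "tres R {\<one>} L (T K L r) = ext_res G R ?Z ?Y ?f (ext_fold G M T ?X ?Y ?f ?s) ?z"
    using lcoset_gset_base[OF e] lcoset_gset_base[OF L] lcoset_map_base[OF e L eL]
      ext_fold_lcoset_map[where M = M and T = T, OF K L KL r M(1,3) T(1)]
    by (simp add: ext_res_def)
  also have "\<dots> = ext_fold G M T (pullback ?X ?Z ?f ?f) ?Z snd
      (ext_res G R (pullback ?X ?Z ?f ?f) ?X fst ?s) ?z"
    using base_change[of ?X ?Y ?Z ?f ?f ?s] K L e KL eL r finite_group
    by (simp add: finite_gset_lcoset_gset gmap_lcoset_map lcoset_family_ext_carrier)
  also have "\<dots> \<in> S"
    by (rule ext_fold_pullback_mem) (use K L KL r M S T in auto)
  finally show ?thesis .
qed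

text \<open>The additive instance of \<open>res_fold_mem\<close>.\<close>

lemma res_tr_mem:
  assumes K: "subgroup K G" and L: "subgroup L G" and KL: "K \<subseteq> L" and r: "r \<in> carrier (tval R K)"
    and S: "S \<subseteq> carrier (tval R {\<one>})" "\<And>a b. a \<in> S \<Longrightarrow> b \<in> S \<Longrightarrow> a \<oplus>\<^bsub>tval R {\<one>}\<^esub> b \<in> S"
      "\<And>g. g \<in> L \<Longrightarrow> tcj R g {\<one>} (tres R {\<one>} K r) \<in> S"
  shows "tres R {\<one>} L (ttr R K L r) \<in> S"
proof -
  interpret L: cring "tval R L" by (rule val_cring[OF L])
  interpret E: cring "tval R {\<one>}" by (rule val_cring[OF triv_subgroup])
  \<comment> \<open>Conjugating the transfer by \<open>g \<in> L\<close> changes its source to the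
    conjugate of \<open>K\<close>, but acts as the identity on \<open>R(G/L)\<close>.\<close>
  have T: "ttr R (conj_set G g K) L (tcj R g K r) = ttr R K L r" if g: "g \<in> L" for g
  proof -
    have gG: "g \<in> carrier G" using g L subgroup.mem_carrier by metis
    show ?thesis
      using cj_tr[OF K L KL gG r] cj_inner[OF L g tr_closed[OF K L KL r]] conj_set_same[OF L g] by simp
  qed
  show ?thesis
    by (rule res_fold_mem[where M = "\<lambda>K. add_monoid (tval R K)" and T = "ttr R", OF K L KL r])
      (use S T triv_subgroup tr_refl base_change_tr[unfolded ext_tr_eq_ext_fold] tr_closed[OF K L KL r] L.a_comm_monoid E.a_comm_monoid
        in auto)
qed

text \<open>The multiplicative instance of \<open>res_fold_mem\<close>; conjugation by
  \<open>g \<in> L\<close> is handled as for transfers.\<close>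

lemma res_nm_mem:
  assumes K: "subgroup K G" and L: "subgroup L G" and KL: "K \<subseteq> L" and r: "r \<in> carrier (tval R K)"
    and S: "S \<subseteq> carrier (tval R {\<one>})" "\<And>a b. a \<in> S \<Longrightarrow> b \<in> S \<Longrightarrow> a \<otimes>\<^bsub>tval R {\<one>}\<^esub> b \<in> S"
      "\<And>g. g \<in> L \<Longrightarrow> tcj R g {\<one>} (tres R {\<one>} K r) \<in> S"
  shows "tres R {\<one>} L (tnm R K L r) \<in> S"
proof -
  interpret L: cring "tval R L" by (rule val_cring[OF L])
  interpret E: cring "tval R {\<one>}" by (rule val_cring[OF triv_subgroup])
  have T: "tnm R (conj_set G g K) L (tcj R g K r) = tnm R K L r" if g: "g \<in> L" for g
  proof -
    have gG: "g \<in> carrier G" using g L subgroup.mem_carrier by metis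
    show ?thesis
      using cj_nm[OF K L KL gG r] cj_inner[OF L g nm_closed[OF K L KL r]] conj_set_same[OF L g] by simp
  qed
  show ?thesis
    by (rule res_fold_mem[where M = "tval R" and T = "tnm R", OF K L KL r])
      (use S T triv_subgroup nm_refl base_change_nm[unfolded ext_nm_eq_ext_fold] nm_closed[OF K L KL r] L.comm_monoid_axioms E.comm_monoid_axioms
        in auto)
qed

end


section \<open>Prime ideals pulled back from the underlying ring\<close>

context tambara_functor begin

text \<open>For an ideal \<open>P\<close> of \<open>R(G/1)\<close> and a subgroup \<open>H\<close>,
  this is the largest \<open>H\<close>-stable ideal contained in \<open>P\<close>.\<close>

definition underlying_ideal :: "'g set \<Rightarrow> 'r set \<Rightarrow> 'r set" where
  "underlying_ideal H P = {a \<in> carrier (tval R {\<one>}). \<forall>h\<in>H. tcj R h {\<one>} a \<in> P}"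

definition pulled_back_ideal :: "'g set \<Rightarrow> 'r set \<Rightarrow> 'g set \<Rightarrow> 'r set" where
  "pulled_back_ideal H P = (\<lambda>L. if subgroup L (G\<lparr>carrier := H\<rparr>)
     then {r \<in> carrier (tval R L). tres R {\<one>} L r \<in> underlying_ideal H P} else {})"

lemma cj_underlying_hom: "g \<in> carrier G \<Longrightarrow> tcj R g {\<one>} \<in> ring_hom (tval R {\<one>}) (tval R {\<one>})"
  using cj_hom[OF triv_subgroup] conj_set_trivial by metis

context
  fixes H P
  assumes H: "subgroup H G" and P: "primeideal P (tval R {\<one>})"
begin

lemma subgroup_restrict_iff: "subgroup L (G\<lparr>carrier := H\<rparr>) \<longleftrightarrow> subgroup L G \<and> L \<subseteq> H"
  using incl_subgroup[OF H] subgroup_incl[OF _ H] subgroup.subset by fastforce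

text \<open>It is the intersection of the preimages of \<open>P\<close> under the ring endomorphisms
  given by the elements of \<open>H\<close>; \<open>\<one> \<in> H\<close> makes the family
  nonempty.\<close>

lemma ideal_underlying_ideal: "ideal (underlying_ideal H P) (tval R {\<one>})"
proof -
  interpret E: cring "tval R {\<one>}" by (rule val_cring[OF triv_subgroup])
  let ?F = "\<lambda>h. {a \<in> carrier (tval R {\<one>}). tcj R h {\<one>} a \<in> P}"
  have "ideal (?F h) (tval R {\<one>})" if "h \<in> H" for h
    using ideal_vimage_hom[OF E.is_cring E.is_cring cj_underlying_hom] P that subgroup.mem_carrier[OF H]
    by (auto simp: primeideal_def)
  moreover have "H \<noteq> {}" using subgroup.one_closed[OF H] by auto
  moreover have "underlying_ideal H P = \<Inter>(?F ` H)"
    using \<open>H \<noteq> {}\<close> by (auto simp: underlying_ideal_def)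
  ultimately show ?thesis by (auto intro: E.i_Intersect)
qed

text \<open>Acting by \<open>h\<close> and then by \<open>g\<close> is acting by
  \<open>g \<otimes> h\<close>, which is again in \<open>H\<close>.\<close>

lemma cj_underlying_ideal:
  assumes "h \<in> H" "a \<in> underlying_ideal H P"
  shows "tcj R h {\<one>} a \<in> underlying_ideal H P"
proof -
  have hG: "g \<in> carrier G" if "g \<in> H" for g using that H subgroup.mem_carrier by metis
  have "tcj R g {\<one>} (tcj R h {\<one>} a) \<in> P" if "g \<in> H" for g
    using assms that hG cj_trans[OF triv_subgroup, of h g a] conj_set_trivial[of h]
      subgroup.m_closed[OF H, of g h] by (simp add: underlying_ideal_def)
  then show ?thesis
    using assms ring_hom_closed[OF cj_underlying_hom[OF hG[OF assms(1)]]]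
    by (auto simp: underlying_ideal_def)
qed

text \<open>All closure conditions are tested after restriction to the trivial subgroup. Transfers
  and norms use \<open>res_tr_mem\<close> and \<open>res_nm_mem\<close> with \<open>S\<close> the
  underlying ideal, restrictions use transitivity, and conjugations use
  \<open>cj_res\<close>.\<close>

lemma tambara_ideal_pulled_back: "tambara_ideal (G\<lparr>carrier := H\<rparr>) R (pulled_back_ideal H P)"
  unfolding tambara_ideal_def
proof (intro conjI allI impI)
  interpret U: ideal "underlying_ideal H P" "tval R {\<one>}" by (rule ideal_underlying_ideal)
  have e: "subgroup {\<one>} G" by (rule triv_subgroup)
  have eL: "{\<one>} \<subseteq> L" if "subgroup L G" for L using that subgroup.one_closed by auto
  note iff = subgroup_restrict_iff
  fix K
  show "pulled_back_ideal H P K = {}" if "\<not> subgroup K (G\<lparr>carrier := H\<rparr>)"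
    using that by (simp add: pulled_back_ideal_def)
  show "ideal (pulled_back_ideal H P K) (tval R K)" if "subgroup K (G\<lparr>carrier := H\<rparr>)"
    using that ideal_vimage_hom[OF val_cring val_cring res_hom ideal_underlying_ideal, of K] e eL
    by (simp add: pulled_back_ideal_def iff)
  {
    fix L assume "subgroup K (G\<lparr>carrier := H\<rparr>)" "subgroup L (G\<lparr>carrier := H\<rparr>)" and KL: "K \<subseteq> L"
    then have K: "subgroup K G" and KH: "K \<subseteq> H" and L: "subgroup L G" and LH: "L \<subseteq> H"
      by (auto simp: iff)
    have mem: "r \<in> pulled_back_ideal H P J \<longleftrightarrow>
        r \<in> carrier (tval R J) \<and> tres R {\<one>} J r \<in> underlying_ideal H P" if "J = K \<or> J = L" for r J
      using that K L KH LH by (auto simp: pulled_back_ideal_def iff)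
    \<comment> \<open>Since \<open>L \<subseteq> H\<close>, stability under \<open>H\<close> covers
      every conjugate that occurs in a transfer or norm to \<open>L\<close>.\<close>
    have cj: "tcj R g {\<one>} (tres R {\<one>} K r) \<in> underlying_ideal H P"
      if "r \<in> pulled_back_ideal H P K" "g \<in> L" for r g
      using that mem LH cj_underlying_ideal by blast
    have sub: "underlying_ideal H P \<subseteq> carrier (tval R {\<one>})" using U.Icarr by blast
    show "ttr R K L ` pulled_back_ideal H P K \<subseteq> pulled_back_ideal H P L"
      using K L KL mem cj res_tr_mem[OF K L KL _ sub] tr_closed U.a_closed by auto
    \<comment> \<open>An ideal absorbs multiplication, so it is closed under the products occurring
      in a norm.\<close>
    show "tnm R K L ` pulled_back_ideal H P K \<subseteq> pulled_back_ideal H P L"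
      using K L KL mem cj res_nm_mem[OF K L KL _ sub] nm_closed U.I_l_closed U.Icarr by auto
    show "tres R K L ` pulled_back_ideal H P L \<subseteq> pulled_back_ideal H P K"
      using K L KL mem res_closed res_trans[OF e K L eL[OF K] KL] by auto
  }
  fix g assume "subgroup K (G\<lparr>carrier := H\<rparr>)" and "g \<in> carrier (G\<lparr>carrier := H\<rparr>)"
  then have K: "subgroup K G" and KH: "K \<subseteq> H" and g: "g \<in> H" and gG: "g \<in> carrier G"
    using subgroup.mem_carrier[OF H] by (auto simp: iff)
  have conj: "conj_set (G\<lparr>carrier := H\<rparr>) g K = conj_set G g K"
    using g H by (simp add: conj_set_def l_coset_def r_coset_def)
  have "conj_set G g K \<subseteq> H"
    using g KH H by (auto simp: conj_set_def l_coset_def r_coset_def subgroup.m_closed subgroup.m_inv_closed)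
  then show "tcj R g K ` pulled_back_ideal H P K \<subseteq> pulled_back_ideal H P (conj_set (G\<lparr>carrier := H\<rparr>) g K)"
    using K KH g gG subgroup_conj_set[OF K gG] cj_closed[OF K gG] cj_underlying_ideal[OF g]
    by (auto simp: pulled_back_ideal_def iff conj
        cj_res[OF e K eL[OF K] gG, unfolded conj_set_trivial[OF gG], symmetric])
qed

text \<open>Containment of a Tambara ideal in \<open>pulled_back_ideal H P\<close> is decided at the
  trivial subgroup. Two ideals that are not contained in it have elements outside \<open>P\<close>
  at that level, and the product of these elements is outside \<open>P\<close> because
  \<open>P\<close> is prime.\<close>

lemma prime_pulled_back: "prime_tambara_ideal (G\<lparr>carrier := H\<rparr>) R (pulled_back_ideal H P)"
  unfolding prime_tambara_ideal_def
proof (intro conjI allI impI)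
  let ?G = "G\<lparr>carrier := H\<rparr>" and ?q = "pulled_back_ideal H P"
  interpret P: primeideal P "tval R {\<one>}" by (rule P)
  have e: "subgroup {\<one>} G" "subgroup {\<one>} ?G"
    using triv_subgroup H by (auto simp: subgroup_restrict_iff subgroup.one_closed)
  have hG: "g \<in> carrier G" if "g \<in> H" for g using that H subgroup.mem_carrier by metis
  have q1: "a \<in> ?q {\<one>} \<longleftrightarrow> a \<in> underlying_ideal H P" for a
    using e res_refl[OF e(1)] by (auto simp: pulled_back_ideal_def underlying_ideal_def)
  show "tambara_ideal ?G R ?q" by (rule tambara_ideal_pulled_back)
  have "\<one>\<^bsub>tval R {\<one>}\<^esub> \<notin> P"
    using P.I_notcarr P.one_imp_carrier by auto
  then have "\<one>\<^bsub>tval R {\<one>}\<^esub> \<notin> ?q {\<one>}"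
    using cj_inner[OF e(1), of \<one> "\<one>\<^bsub>tval R {\<one>}\<^esub>"] subgroup.one_closed[OF H]
    by (force simp: q1 underlying_ideal_def)
  then show "?q \<noteq> unit_ideal ?G R"
    using e by (auto simp: unit_ideal_def fun_eq_iff)
  fix I J
  assume I: "tambara_ideal ?G R I" and J: "tambara_ideal ?G R J" and IJ: "prod_ideal ?G R I J \<le> ?q"
  \<comment> \<open>Restriction maps \<open>I K\<close> into \<open>I {\<one>}\<close>, so the
    condition at the trivial subgroup controls every level.\<close>
  have sub: "I \<le> ?q" if I: "tambara_ideal ?G R I" and Ie: "I {\<one>} \<subseteq> underlying_ideal H P" for I
  proof (rule le_funI)
    fix K
    show "I K \<le> ?q K"
    proof (cases "subgroup K ?G")
      case True
      then have "ideal (I K) (tval R K)" "tres R {\<one>} K ` I K \<subseteq> I {\<one>}"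
        using I e(2) subgroup.one_closed[OF True] by (auto simp: tambara_ideal_def)
      then show ?thesis using True Ie ideal.Icarr by (fastforce simp: pulled_back_ideal_def)
    qed (use I in \<open>simp add: tambara_ideal_def\<close>)
  qed
  show "I \<le> ?q \<or> J \<le> ?q"
  proof (rule ccontr)
    \<comment> \<open>An element outside the underlying ideal has a translate outside
      \<open>P\<close>. As \<open>I\<close> is closed under conjugation, the translate stays in
      \<open>I {\<one>}\<close> and serves as witness.\<close>
    have wit: "\<exists>a\<in>I {\<one>}. a \<in> carrier (tval R {\<one>}) \<and> a \<notin> P"
      if I: "tambara_ideal ?G R I" and nle: "\<not> I \<le> ?q" for I
    proof -
      have Ie: "ideal (I {\<one>}) (tval R {\<one>})" using I e by (simp add: tambara_ideal_def)
      obtain a where a: "a \<in> I {\<one>}" "a \<notin> underlying_ideal H P" using sub[OF I] nle by blast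
      then obtain h where h: "h \<in> H" "tcj R h {\<one>} a \<notin> P"
        using ideal.Icarr[OF Ie] by (auto simp: underlying_ideal_def)
      have "conj_set ?G h {\<one>} = {\<one>}"
        using h hG H by (simp add: conj_set_def l_coset_def r_coset_def)
      moreover have "tcj R h {\<one>} ` I {\<one>} \<subseteq> I (conj_set ?G h {\<one>})"
        using I e h by (simp add: tambara_ideal_def)
      ultimately have "tcj R h {\<one>} a \<in> I {\<one>}" using a by auto
      then show ?thesis using h ideal.Icarr[OF Ie] by blast
    qed
    assume "\<not> (I \<le> ?q \<or> J \<le> ?q)"
    then obtain a b where a: "a \<in> I {\<one>}" "a \<in> carrier (tval R {\<one>})" "a \<notin> P"
      and b: "b \<in> J {\<one>}" "b \<in> carrier (tval R {\<one>})" "b \<notin> P"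
      using wit[OF I] wit[OF J] by blast
    have "a \<otimes>\<^bsub>tval R {\<one>}\<^esub> b \<in> I {\<one>} \<cdot>\<^bsub>tval R {\<one>}\<^esub> J {\<one>}"
      using a b by (intro ideal_prod.prod)
    then have "a \<otimes>\<^bsub>tval R {\<one>}\<^esub> b \<in> prod_ideal ?G R I J {\<one>}"
      using e by (auto simp: prod_ideal_def)
    then have "a \<otimes>\<^bsub>tval R {\<one>}\<^esub> b \<in> underlying_ideal H P" using IJ q1 by (auto simp: le_fun_def)
    then have "tcj R \<one> {\<one>} (a \<otimes>\<^bsub>tval R {\<one>}\<^esub> b) \<in> P"
      using subgroup.one_closed[OF H] by (auto simp: underlying_ideal_def)
    then have "a \<otimes>\<^bsub>tval R {\<one>}\<^esub> b \<in> P"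
      using cj_inner[OF e(1), of \<one>] a b by simp
    then show False using a b P.I_prime by blast
  qed
qed

end

section \<open>Nonemptiness of the stratum and the zero ideal as generic point\<close>

lemma domain_like_underlying_nontrivial:
  assumes "domain_like G R"
  shows "\<one>\<^bsub>tval R {\<one>}\<^esub> \<noteq> \<zero>\<^bsub>tval R {\<one>}\<^esub>"
proof
  assume triv: "\<one>\<^bsub>tval R {\<one>}\<^esub> = \<zero>\<^bsub>tval R {\<one>}\<^esub>"
  have zero: "tambara_ideal G R (zero_ideal G R)" "zero_ideal G R \<noteq> unit_ideal G R"
    using assms by (simp_all add: domain_like_def prime_tambara_ideal_def)
  have "zero_ideal G R K = unit_ideal G R K" for K
  proof (cases "subgroup K G")
    case K: True
    have e: "subgroup {\<one>} G" "{\<one>} \<subseteq> K" using triv_subgroup subgroup.one_closed[OF K] by auto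
    interpret cring "tval R K" by (rule val_cring[OF K])
    \<comment> \<open>\<open>N(0) = 0\<close> is read off from the zero ideal being closed under
      norms; together with \<open>N(1) = 1\<close> it carries \<open>1 = 0\<close> from the trivial
      subgroup to \<open>K\<close>.\<close>
    have "tnm R {\<one>} K ` zero_ideal G R {\<one>} \<subseteq> zero_ideal G R K"
      using zero(1) e K by (simp add: tambara_ideal_def)
    then have "\<one>\<^bsub>tval R K\<^esub> = \<zero>\<^bsub>tval R K\<^esub>"
      using e K nm_one[OF e(1) K e(2)] triv by (simp add: zero_ideal_def)
    then show ?thesis using K carrier_one_zero by (simp add: zero_ideal_def unit_ideal_def)
  qed (simp add: zero_ideal_def unit_ideal_def)
  then show False using zero(2) by blast
qed

text \<open>The stratum is an image, so one prime of the restricted functor suffices; a maximal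
  ideal of the underlying ring provides it.\<close>

lemma stratum_nonempty:
  assumes "domain_like G R" "subgroup H G"
  shows "stratum G H R \<noteq> {}"
proof -
  interpret E: cring "tval R {\<one>}" by (rule val_cring[OF triv_subgroup])
  obtain P where "primeideal P (tval R {\<one>})"
    using E.exists_maximalideal[OF domain_like_underlying_nontrivial[OF assms(1)]] E.maximalideal_prime by blast
  then have "pulled_back_ideal H P \<in> Nak_Spec (G\<lparr>carrier := H\<rparr>) R"
    using prime_pulled_back[OF assms(2)] by (simp add: Nak_Spec_def)
  then show ?thesis by (auto simp: stratum_def Res_tambara_def)
qed

text \<open>At level \<open>G/G\<close> there is a single coset, whose stabilizer in
  \<open>H\<close> is \<open>H\<close>. The unit of the adjunction is therefore the restriction to
  \<open>H\<close> there, and it sends \<open>x\<close> to the zero family.\<close>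

lemma kernel_in_preimage:
  assumes H: "subgroup H G" and x: "x \<in> carrier (tval R (carrier G))"
    and ker: "tres R H (carrier G) x = \<zero>\<^bsub>tval R H\<^esub>"
    and q: "tambara_ideal (G\<lparr>carrier := H\<rparr>) R q"
  shows "x \<in> preimage_ideal G R (CoInd_unit G H R) (CoInd_ideal G H R q) (carrier G)"
proof -
  let ?X = "coset_gset G (carrier G)" and ?G = "G\<lparr>carrier := H\<rparr>"
  have GG: "subgroup (carrier G) G" by (rule subgroup_self)
  have HG: "H \<subseteq> carrier G" using H by (rule subgroup.subset)
  have HH: "subgroup H ?G" using subgroup_incl[OF H H] by simp
  have cos: "g <# carrier G = carrier G" if "g \<in> carrier G" for g
    using that GG by (simp add: coset_join3)
  then have pts: "pts ?X = {carrier G}" by (auto simp: coset_gset_def LCOSETS_def)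
  have act: "act ?X g (carrier G) = carrier G" if "g \<in> carrier G" for g
    using that cos pts by (simp add: coset_gset_def)
  then have st: "stab G ?X (carrier G) = carrier G" "stab ?G ?X (carrier G) = H"
    using HG by (auto simp: stabilizer_def)
  \<comment> \<open>Whichever representative \<open>orbit_family\<close> picks, conjugation by it is
    trivial on \<open>R(G/G)\<close>.\<close>
  have "(SOME g. g \<in> carrier G) \<in> carrier G" using one_closed by (rule someI)
  then have "CoInd_unit G H R (carrier G) x = (\<lambda>C\<in>{carrier G}. \<zero>\<^bsub>tval R H\<^esub>)"
    using cj_inner[OF GG _ x] ker by (auto simp: CoInd_unit_def orbit_family_def pts st Let_def)
  moreover have "\<zero>\<^bsub>tval R H\<^esub> \<in> q H"
    using q HH by (auto simp: tambara_ideal_def intro!: additive_subgroup.zero_closed ideal.axioms(1))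
  \<comment> \<open>Compatibility with conjugation, required for the zero family to lie in
    \<open>ext_carrier\<close>.\<close>
  moreover have "tcj R h H \<zero>\<^bsub>tval R H\<^esub> = \<zero>\<^bsub>tval R H\<^esub>" if "h \<in> H" for h
    using cj_inner[OF H that] val_cring[OF H] by (simp add: cring.axioms(1) ring.ring_simprules(2))
  moreover have "\<zero>\<^bsub>tval R H\<^esub> \<in> carrier (tval R H)"
    using val_cring[OF H] by (simp add: cring.axioms(1) ring.ring_simprules(2))
  ultimately show ?thesis
    using x GG act HG by (auto simp: preimage_ideal_def CoInd_ideal_def ext_ideal_def ext_carrier_def pts st)
qed

lemma zero_ideal_notin_stratum:
  assumes H: "subgroup H G"
    and inj: "\<not> inj_on (tres R H (carrier G)) (carrier (tval R (carrier G)))"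
  shows "zero_ideal G R \<notin> stratum G H R"
proof
  have GG: "subgroup (carrier G) G" by (rule subgroup_self)
  interpret ring_hom_ring "tval R (carrier G)" "tval R H" "tres R H (carrier G)"
    using val_cring[OF GG] val_cring[OF H] res_hom[OF H GG subgroup.subset[OF H]]
    by (intro ring_hom_ringI2) (auto simp: cring.axioms)
  obtain a b where ab: "a \<in> carrier (tval R (carrier G))" "b \<in> carrier (tval R (carrier G))"
    "tres R H (carrier G) a = tres R H (carrier G) b" "a \<noteq> b"
    using inj by (auto simp: inj_on_def)
  \<comment> \<open>The difference of two elements with equal restriction is a nonzero kernel
    element, which every ideal in the stratum contains.\<close>
  define x where "x = a \<ominus>\<^bsub>tval R (carrier G)\<^esub> b"
  have x: "x \<in> carrier (tval R (carrier G))" "tres R H (carrier G) x = \<zero>\<^bsub>tval R H\<^esub>"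
    "x \<noteq> \<zero>\<^bsub>tval R (carrier G)\<^esub>"
    using ab by (simp_all add: x_def) (simp add: R.minus_eq S.r_neg)
  assume "zero_ideal G R \<in> stratum G H R"
  then obtain q where "tambara_ideal (G\<lparr>carrier := H\<rparr>) R q"
    "zero_ideal G R = preimage_ideal G R (CoInd_unit G H R) (CoInd_ideal G H R q)"
    by (auto simp: stratum_def Res_tambara_def Nak_Spec_def prime_tambara_ideal_def)
  then have "x \<in> zero_ideal G R (carrier G)"
    using kernel_in_preimage[OF H x(1,2)] by simp
  then show False using x(3) GG by (simp add: zero_ideal_def)
qed

lemma zero_ideal_le:
  assumes "tambara_ideal G R I"
  shows "zero_ideal G R \<le> I"
  using assms
  by (auto simp: zero_ideal_def tambara_ideal_def le_fun_def
      intro!: additive_subgroup.zero_closed ideal.axioms(1))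

text \<open>If the zero ideal lay in the closed complement \<open>V(I)\<close>, then
  \<open>I\<close> would be contained in the zero ideal, hence in every prime, and the open set
  would be empty.\<close>

lemma zero_ideal_in_open:
  assumes "domain_like G R" "openin (Nak_topology G R) U" "U \<noteq> {}"
  shows "zero_ideal G R \<in> U"
proof -
  obtain I where I: "tambara_ideal G R I" "U = Nak_Spec G R - Nak_V G R I"
    using assms(2) openin_Nak_topology by auto
  have "\<not> I \<le> zero_ideal G R"
  proof
    assume "I \<le> zero_ideal G R"
    then have "I \<le> p" if "p \<in> Nak_Spec G R" for p
      using that zero_ideal_le[of p] by (auto simp: Nak_Spec_def prime_tambara_ideal_def)
    then show False using I(2) assms(3) by (auto simp: Nak_V_def)
  qed
  then show ?thesis
    using assms(1) I(2) by (simp add: Nak_Spec_def Nak_V_def domain_like_def)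
qed

end

theorem theoremF:
  fixes G :: "('g, 'm) monoid_scheme" and H :: "'g set" and R :: "('g, 'r) tambara"
  assumes "tambara_functor G R"
    and "subgroup H G"
    and "domain_like G R"
    and "\<not> inj_on (tres R H (carrier G)) (carrier (tval R (carrier G)))"
  shows "\<not> openin (Nak_topology G R) (stratum G H R)"
proof -
  interpret tambara_functor G R by fact
  show ?thesis
    using zero_ideal_in_open stratum_nonempty zero_ideal_notin_stratum assms by blast
qed

end
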